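(* Let $n \in \mathbb{N}$ ($n\ge 1$), $a,b,c,d \in \mathbb{C}$, and let $\lambda_1,\dots,\lambda_{n+2}$ and the $n\times n$ matrix $\mathbf{H}_n$ be as defined in the context. (a) If $n$ is even, then the eigenvalues of $\mathbf{H}_{n}$ are precisely the zeros of the two polynomials $$f(t) = \prod_{j=1}^{n/2} (t - \lambda_{2j+1}) + (t - \lambda_{1}) \sum_{j=1}^{n/2} \frac{\sin^{2} \left(\frac{(2j + 1)\pi}{n + 3} \right)}{\sin^{2} \left(\frac{\pi}{n + 3} \right)} \prod_{\substack{m=1 \\ m \neq j}}^{n/2} (t - \lambda_{2m+1})$$ and $$g(t) = \prod_{j=1}^{n/2} (t - \lambda_{2j}) + (t - \lambda_{n+2}) \sum_{j=1}^{n/2} \frac{\sin^{2} \left(\frac{2j\pi}{n + 3} \right)}{\sin^{2} \left(\frac{\pi}{n + 3} \right)} \prod_{\substack{m=1 \\ m \neq j}}^{n/2} (t - \lambda_{2m}).$$ (b) If $n$ is odd, then the eigenvalues of $\mathbf{H}_{n}$ are precisely the zeros of the two polynomials $$f(t) = \prod_{j=1}^{(n+1)/2} (t - \lambda_{2j+1}) + (t - \lambda_{1}) \sum_{j=1}^{(n+1)/2} \frac{\sin^{2} \left(\frac{(2j + 1)\pi}{n + 3} \right)}{\sin^{2} \left(\frac{\pi}{n + 3} \right)} \prod_{\substack{m=1 \\ m \neq j}}^{(n+1)/2}(t - \lambda_{2m+1})$$ and $$g(t) = \prod_{j=1}^{(n-1)/2}(t - \lambda_{2j}) + (t - \lambda_{n+1})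 \sum_{j=1}^{(n-1)/2} \frac{\sin^{2} \left(\frac{2j\pi}{n + 3} \right)}{\sin^{2} \left(\frac{(n+1)\pi}{n + 3} \right)} \prod_{\substack{m=1 \\ m \neq j}}^{(n-1)/2} (t - \lambda_{2m}).$$ That is, a complex number is an eigenvalue of $\mathbf{H}_n$ if and only if it is a zero of $f$ or of $g$.
   Context: For $n\in\mathbb{N}$ and scalars $a,b,c,d$, $\mathbf{H}_n$ is the $n\times n$ anti-heptadiagonal persymmetric Hankel matrix with entries $[\mathbf{H}_n]_{k,\ell}=d$ if $k+\ell=n+1$; $=c$ if $|k+\ell-n-1|=1$; $=b$ if $|k+\ell-n-1|=2$; $=a$ if $|k+\ell-n-1|=3$; and $=0$ otherwise. For $k=1,2,\ldots,n+2$, $$\lambda_{k} = -2a \cos \left(\tfrac{n k \pi}{n+3} \right) - 2b \cos \left(\tfrac{(n + 1) k \pi}{n+3} \right) - 2c \cos \left(\tfrac{(n + 2) k \pi}{n+3} \right) - d \cos (k \pi).$$ Empty products equal $1$ and empty sums equal $0$. *)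

theory Defs
  imports Complex_Main "Jordan_Normal_Form.Char_Poly"
begin

text \<open>Jordan_Normal_Form indexes rows and columns from 0, so the entry at \<open>(i, j)\<close>
  is the one that the usual 1-based convention puts at \<open>(k, l) = (i + 1, j + 1)\<close>.\<close>

definition hankel_entry :: "nat \<Rightarrow> complex \<Rightarrow> complex \<Rightarrow> complex \<Rightarrow> complex \<Rightarrow> nat \<Rightarrow> nat \<Rightarrow> complex" where
  "hankel_entry n a b c d k l =
     (let s = \<bar>int k + int l - int n - 1\<bar> in
      if s = 0 then d else if s = 1 then c else if s = 2 then b else if s = 3 then a else 0)"

definition hankel_mat :: "nat \<Rightarrow> complex \<Rightarrow> complex \<Rightarrow> complex \<Rightarrow> complex \<Rightarrow> complex mat" where
  "hankel_mat n a b c d = mat n n (\<lambda>(i, j). hankel_entry n a b c d (i + 1) (j + 1))"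

definition lam :: "nat \<Rightarrow> complex \<Rightarrow> complex \<Rightarrow> complex \<Rightarrow> complex \<Rightarrow> nat \<Rightarrow> complex" where
  "lam n a b c d k =
     - 2 * a * of_real (cos (real (n * k) * pi / real (n + 3)))
     - 2 * b * of_real (cos (real ((n + 1) * k) * pi / real (n + 3)))
     - 2 * c * of_real (cos (real ((n + 2) * k) * pi / real (n + 3)))
     - d * of_real (cos (real k * pi))"

definition sin_ratio :: "nat \<Rightarrow> nat \<Rightarrow> nat \<Rightarrow> complex" where
  "sin_ratio n p q =
     of_real ((sin (real p * pi / real (n + 3)))\<^sup>2 / (sin (real q * pi / real (n + 3)))\<^sup>2)"

abbreviation lin :: "complex \<Rightarrow> complex poly" where
  "lin z \<equiv> [:- z, 1:]"

definition f_even :: "nat \<Rightarrow> complex \<Rightarrow> complex \<Rightarrow> complex \<Rightarrow> complex \<Rightarrow> complex poly" where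
  "f_even n a b c d =
     (\<Prod>j = 1..n div 2. lin (lam n a b c d (2 * j + 1)))
     + lin (lam n a b c d 1) *
       (\<Sum>j = 1..n div 2. Polynomial.smult (sin_ratio n (2 * j + 1) 1)
          (\<Prod>m \<in> {1..n div 2} - {j}. lin (lam n a b c d (2 * m + 1))))"

definition g_even :: "nat \<Rightarrow> complex \<Rightarrow> complex \<Rightarrow> complex \<Rightarrow> complex \<Rightarrow> complex poly" where
  "g_even n a b c d =
     (\<Prod>j = 1..n div 2. lin (lam n a b c d (2 * j)))
     + lin (lam n a b c d (n + 2)) *
       (\<Sum>j = 1..n div 2. Polynomial.smult (sin_ratio n (2 * j) 1)
          (\<Prod>m \<in> {1..n div 2} - {j}. lin (lam n a b c d (2 * m))))"

definition f_odd :: "nat \<Rightarrow> complex \<Rightarrow> complex \<Rightarrow> complex \<Rightarrow> complex \<Rightarrow> complex poly" where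
  "f_odd n a b c d =
     (\<Prod>j = 1..(n + 1) div 2. lin (lam n a b c d (2 * j + 1)))
     + lin (lam n a b c d 1) *
       (\<Sum>j = 1..(n + 1) div 2. Polynomial.smult (sin_ratio n (2 * j + 1) 1)
          (\<Prod>m \<in> {1..(n + 1) div 2} - {j}. lin (lam n a b c d (2 * m + 1))))"

definition g_odd :: "nat \<Rightarrow> complex \<Rightarrow> complex \<Rightarrow> complex \<Rightarrow> complex \<Rightarrow> complex poly" where
  "g_odd n a b c d =
     (\<Prod>j = 1..(n - 1) div 2. lin (lam n a b c d (2 * j)))
     + lin (lam n a b c d (n + 1)) *
       (\<Sum>j = 1..(n - 1) div 2. Polynomial.smult (sin_ratio n (2 * j) (n + 1))
          (\<Prod>m \<in> {1..(n - 1) div 2} - {j}. lin (lam n a b c d (2 * m))))"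

end

theory Submission
  imports Defs
begin

text \<open>
  Let \<open>s\<^sub>k(i) = sin (i k \<pi> / (n + 3))\<close> for \<open>1 \<le> i, k \<le> n + 2\<close> (the discrete sine basis).
  The matrix \<open>H\<^sub>n\<close> consists of rows and columns \<open>2, \<dots>, n + 1\<close> of the operator on \<open>n + 2\<close>
  points with \<open>s\<^sub>k \<mapsto> \<lambda>\<^sub>k s\<^sub>k\<close>: all corrections that the operator needs at the boundary
  involve the first or the last point. So \<open>t\<close> is an eigenvalue iff there is
  \<open>w = \<Sum>\<^sub>k x\<^sub>k s\<^sub>k \<noteq> 0\<close> with \<open>w(1) = w(n + 2) = 0\<close> whose image under the operator minus \<open>t\<close> is
  supported on \<open>{1, n + 2}\<close>. Since \<open>s\<^sub>k(n + 2) = (- 1)^(k + 1) s\<^sub>k(1)\<close>, the odd and the even \<open>k\<close>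
  decouple, and each parity class \<open>K\<close> gives the rank-one problem \<open>(\<lambda>\<^sub>k - t) x\<^sub>k = \<alpha> s\<^sub>k(1)\<close>,
  \<open>\<Sum>\<^sub>k x\<^sub>k s\<^sub>k(1) = 0\<close>. Its secular equation
  \<open>\<Sum>\<^sub>k s\<^sub>k(1)^2 \<Prod>\<^sub>m\<^sub>\<noteq>\<^sub>k (t - \<lambda>\<^sub>m) = 0\<close> is the vanishing of \<open>f\<close> or \<open>g\<close>, up to a nonzero factor.
\<close>

section \<open>Orthogonality and inversion of the discrete sine basis\<close>

lemma sum_cos_telescope:
  fixes x :: real
  shows "2 * sin (x / 2) * (\<Sum>k<N. cos (real k * x)) = sin ((real N - 1/2) * x) + sin (x / 2)"
proof (induction N)
  case 0
  then show ?case by simp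
next
  case (Suc N)
  have e1: "(real (Suc N) - 1/2) * x = real N * x + x / 2"
    and e2: "(real N - 1/2) * x = real N * x - x / 2"
    by (simp_all add: field_simps)
  show ?case
    using Suc unfolding e1 e2 sum.lessThan_Suc distrib_left sin_add sin_diff
    by (simp add: algebra_simps)
qed

text \<open>The bounds on \<open>m\<close> keep \<open>m * pi / (2 * N)\<close> away from the
  multiples of \<open>pi\<close>, so the telescoped sum can be divided by its sine factor. The value
  depends only on the parity of \<open>m\<close>.\<close>

lemma sum_cos_multiples:
  fixes m :: int
  assumes "m \<noteq> 0" "\<bar>m\<bar> < 2 * int N"
  shows "(\<Sum>k<N. cos (real k * (m * pi / N))) = (1 - cos (m * pi)) / 2"
proof -
  have N: "N > 0" using assms by linarith
  have nz: "sin (m * pi / N / 2) \<noteq> 0"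
  proof
    assume "sin (m * pi / N / 2) = 0"
    then obtain i :: int where "m * pi / N / 2 = i * pi"
      unfolding sin_zero_iff_int2 by auto
    then have "real_of_int m = real_of_int (2 * int N * i)"
      using N by (simp add: field_simps)
    then have m: "m = 2 * int N * i" by linarith
    with assms(1) have "\<bar>i\<bar> \<ge> 1" by auto
    then have "2 * int N * \<bar>i\<bar> \<ge> 2 * int N * 1"
      by (intro mult_left_mono) auto
    then show False using assms(2) by (simp add: m abs_mult)
  qed
  have e: "(real N - 1/2) * (m * pi / N) = m * pi - m * pi / N / 2"
    using N by (simp add: field_simps)
  have "2 * sin (m * pi / N / 2) * (\<Sum>k<N. cos (real k * (m * pi / N)))
      = sin (m * pi / N / 2) * (1 - cos (m * pi))"
    unfolding sum_cos_telescope e sin_diff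
    by (simp add: algebra_simps)
  moreover have "S = x / 2" if "2 * s * S = s * x" "s \<noteq> 0" for s S x :: real
    using that by auto
  ultimately show ?thesis using nz by blast
qed

text \<open>Product-to-sum leaves half the difference of the cosine sums at \<open>i - j\<close> and
  \<open>i + j\<close>. These numbers have the same parity, so the two sums cancel unless
  \<open>i = j\<close>, where the first is \<open>N\<close> and the second is 0.\<close>

lemma sum_sin_sin:
  fixes i j :: nat
  assumes "i \<in> {1..<N}" "j \<in> {1..<N}"
  shows "(\<Sum>k<N. sin (real i * real k * pi / N) * sin (real j * real k * pi / N))
         = (if i = j then N / 2 else 0)"
proof -
  let ?C = "\<lambda>m::int. \<Sum>k<N. cos (real k * (m * pi / N))"
  have "(\<Sum>k<N. sin (real i * real k * pi / N) * sin (real j * real k * pi / N))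
      = (\<Sum>k<N. (cos (real k * ((int i - int j) * pi / N)) - cos (real k * ((int i + int j) * pi / N))) / 2)"
    by (intro sum.cong refl)
       (simp add: sin_times_sin add_divide_distrib diff_divide_distrib algebra_simps)
  also have "\<dots> = (?C (int i - int j) - ?C (int i + int j)) / 2"
    by (simp add: sum_divide_distrib [symmetric] sum_subtractf)
  finally have *: "(\<Sum>k<N. sin (real i * real k * pi / N) * sin (real j * real k * pi / N))
      = (?C (int i - int j) - ?C (int i + int j)) / 2" .
  have plus: "?C (int i + int j) = (1 - cos ((int i + int j) * pi)) / 2"
    using sum_cos_multiples[of "int i + int j" N] assms by auto
  have par: "cos (real_of_int (int i - int j) * pi) = cos (real_of_int (int i + int j) * pi)"
    by (simp add: distrib_right left_diff_distrib cos_add cos_diff)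
  show ?thesis
  proof (cases "i = j")
    case True
    then show ?thesis using * plus par by simp
  next
    case False
    then have "?C (int i - int j) = (1 - cos ((int i - int j) * pi)) / 2"
      using assms by (intro sum_cos_multiples) auto
    then show ?thesis using False * plus par by simp
  qed
qed

text \<open>The point \<open>i\<close> is an integer because the matrix stencil also evaluates the
  basis outside \<open>1..n+2\<close>, down to the point \<open>-1\<close>.\<close>

definition sine :: "nat \<Rightarrow> int \<Rightarrow> nat \<Rightarrow> complex" where
  "sine n i k = of_real (sin (real_of_int i * real k * pi / real (n + 3)))"

lemma sine_commute: "sine n (int i) k = sine n (int k) i"
  by (simp add: sine_def mult_ac)

lemma sine_minus: "sine n (- i) k = - sine n i k"
  by (simp add: sine_def)

text \<open>The new angle is \<open>k * pi\<close> minus the old one. This gives the sign at the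
  last point, the odd symmetry about \<open>n + 3\<close>, and the index reversal inherent in a
  Hankel matrix.\<close>

lemma sine_reflect: "sine n (int n + 3 - i) k = (- 1) ^ (k + 1) * sine n i k"
proof -
  have "real_of_int (int n + 3 - i) * real k * pi / real (n + 3)
      = k * pi - i * k * pi / real (n + 3)"
    by (simp add: field_simps)
  then show ?thesis by (simp add: sine_def sin_diff)
qed

lemma sine_one_nonzero:
  assumes "k \<in> {1..n+2}"
  shows "sine n 1 k \<noteq> 0"
proof -
  have "real k * pi < pi * real (n + 3)" using assms by (simp add: mult.commute)
  then have "sin (real k * pi / real (n + 3)) > 0"
    using assms by (intro sin_gt_zero) (simp_all add: pos_divide_less_eq del: of_nat_add)
  then show ?thesis by (simp add: sine_def)
qed

lemma sine_orthogonal: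
  assumes "i \<in> {1..n+2}" "j \<in> {1..n+2}"
  shows "(\<Sum>k=1..n+2. sine n (int i) k * sine n (int j) k) = (if i = j then of_nat (n + 3) / 2 else 0)"
proof -
  \<comment> \<open>Frequency 0 contributes nothing and completes the range of
    \<open>sum_sin_sin\<close>.\<close>
  have eq: "{..<n+3} = insert 0 {1..n+2}" by auto
  have "(\<Sum>k=1..n+2. sine n (int i) k * sine n (int j) k)
     = (\<Sum>k<n+3. sine n (int i) k * sine n (int j) k)"
    unfolding eq by (subst sum.insert) (auto simp: sine_def)
  also have "\<dots> = of_real (\<Sum>k<n+3. sin (real i * real k * pi / real (n+3)) * sin (real j * real k * pi / real (n+3)))"
    by (simp add: sine_def)
  also have "\<dots> = (if i = j then of_nat (n + 3) / 2 else 0)"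
    using assms by (subst sum_sin_sin) (auto simp: complex_eq_iff)
  finally show ?thesis .
qed

lemma sine_inversion:
  assumes "i \<in> {1..n+2}"
  shows "(\<Sum>k=1..n+2. (2 / of_nat (n + 3) * (\<Sum>j=1..n+2. u j * sine n (int j) k)) * sine n (int i) k) = u i"
proof -
  have "(\<Sum>k=1..n+2. (2 / of_nat (n + 3) * (\<Sum>j=1..n+2. u j * sine n (int j) k)) * sine n (int i) k)
     = (\<Sum>k=1..n+2. \<Sum>j=1..n+2. 2 / of_nat (n + 3) * u j * (sine n (int j) k * sine n (int i) k))"
    by (simp only: sum_distrib_left sum_distrib_right mult_ac)
  also have "\<dots> = (\<Sum>j=1..n+2. \<Sum>k=1..n+2. 2 / of_nat (n + 3) * u j * (sine n (int j) k * sine n (int i) k))"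
    by (rule sum.swap)
  also have "\<dots> = (\<Sum>j=1..n+2. 2 / of_nat (n + 3) * u j * (if j = i then of_nat (n + 3) / 2 else 0))"
    unfolding sum_distrib_left [symmetric]
    using assms by (intro sum.cong refl arg_cong2[of _ _ _ _ "(*)"] sine_orthogonal) auto
  also have "\<dots> = (\<Sum>j=1..n+2. if j = i then u i else 0)"
    by (intro sum.cong refl) (auto simp del: of_nat_add)
  also have "\<dots> = u i"
    using assms by simp
  finally show ?thesis .
qed

text \<open>By \<open>sine_commute\<close>, points and frequencies can be exchanged in
  \<open>sine_inversion\<close>, so the transform is inverted from the other side as well.\<close>

lemma sine_coefficients:
  assumes "k \<in> {1..n+2}"
  shows "y k = 2 / of_nat (n + 3) * (\<Sum>i=1..n+2. (\<Sum>m=1..n+2. y m * sine n (int i) m) * sine n (int i) k)"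
proof -
  have "y k = (\<Sum>i=1..n+2. (2 / of_nat (n + 3) * (\<Sum>m=1..n+2. y m * sine n (int m) i)) * sine n (int k) i)"
    by (rule sine_inversion[OF assms, symmetric])
  also have "\<dots> = (\<Sum>i=1..n+2. (2 / of_nat (n + 3) * (\<Sum>m=1..n+2. y m * sine n (int i) m)) * sine n (int i) k)"
    by (intro sum.cong refl arg_cong2[of _ _ _ _ "(*)"]) (rule sine_commute)+
  finally show ?thesis by (simp only: sum_distrib_left [symmetric] mult.assoc)
qed

section \<open>Action of the Hankel matrix in the sine basis\<close>

text \<open>The coefficient at \<open>l\<close> depends only on the distance from
  \<open>l + 1\<close> to \<open>q\<close>, so the row is a symmetric stencil centred at
  \<open>q\<close>. The zeros of \<open>w\<close> at three points on either side allow the stencil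
  to be completed.\<close>

lemma hankel_entry_sum:
  fixes w :: "int \<Rightarrow> complex"
  assumes p: "p \<in> {1..n}"
    and w0: "\<And>j. j \<in> {-1, 0, 1, int n + 2, int n + 3, int n + 4} \<Longrightarrow> w j = 0"
  defines "q \<equiv> int n + 2 - int p"
  shows "(\<Sum>l=1..n. hankel_entry n a b c d p l * w (int l + 1))
    = d * w q + c * (w (q + 1) + w (q - 1)) + b * (w (q + 2) + w (q - 2)) + a * (w (q + 3) + w (q - 3))"
proof -
  define h where "h s = (if s = 0 then d else if s = 1 then c else if s = 2 then b else if s = 3 then a else 0)"
    for s :: int
  have "(\<Sum>l=1..n. hankel_entry n a b c d p l * w (int l + 1))
      = (\<Sum>j\<in>{2..int n + 1}. h \<bar>j - q\<bar> * w j)"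
    by (rule sum.reindex_bij_witness[of _ "\<lambda>j. nat (j - 1)" "\<lambda>l. int l + 1"])
       (auto simp: hankel_entry_def h_def q_def Let_def algebra_simps)
  also have "\<dots> = (\<Sum>j\<in>{-1..int n + 4}. h \<bar>j - q\<bar> * w j)"
  proof (rule sum.mono_neutral_left)
    show "\<forall>j\<in>{-1..int n + 4} - {2..int n + 1}. h \<bar>j - q\<bar> * w j = 0"
    proof
      fix j assume "j \<in> {-1..int n + 4} - {2..int n + 1}"
      then have "j \<in> {-1, 0, 1, int n + 2, int n + 3, int n + 4}" by auto
      then show "h \<bar>j - q\<bar> * w j = 0" using w0 by simp
    qed
  qed auto
  \<comment> \<open>As \<open>q\<close> lies in \<open>2..n+1\<close>, the seven-point window fits
    into the enlarged range; outside the window \<open>h\<close> vanishes.\<close>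
  also have "\<dots> = (\<Sum>j\<in>{q - 3..q + 3}. h \<bar>j - q\<bar> * w j)"
    using p by (intro sum.mono_neutral_right) (auto simp: q_def h_def)
  also have "{q - 3..q + 3} = {q - 3, q - 2, q - 1, q, q + 1, q + 2, q + 3}" by auto
  also have "(\<Sum>j\<in>\<dots>. h \<bar>j - q\<bar> * w j)
      = d * w q + c * (w (q + 1) + w (q - 1)) + b * (w (q + 2) + w (q - 2)) + a * (w (q + 3) + w (q - 3))"
    by (simp add: h_def algebra_simps)
  finally show ?thesis .
qed

text \<open>Each symmetric pair of shifts is diagonal in the sine basis, hence so is the whole
  stencil.\<close>

lemma sine_add_diff:
  "sine n (q + r) k + sine n (q - r) k = 2 * of_real (cos (r * k * pi / real (n + 3))) * sine n q k"
proof -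
  have "real_of_int (q + r) * k * pi / real (n + 3) = q * k * pi / real (n + 3) + r * k * pi / real (n + 3)"
    "real_of_int (q - r) * k * pi / real (n + 3) = q * k * pi / real (n + 3) - r * k * pi / real (n + 3)"
    by (simp_all add: add_divide_distrib diff_divide_distrib algebra_simps)
  then show ?thesis
    by (simp add: sine_def sin_add sin_diff)
qed

text \<open>The angles in \<open>lam\<close> are \<open>k * pi\<close> minus small multiples of
  \<open>k * pi / (n + 3)\<close>. The last factor is the eigenvalue of the stencil; the sign is the
  one in \<open>sine_reflect\<close>.\<close>

lemma lam_alt:
  fixes n k :: nat
  defines "C \<equiv> \<lambda>r::int. complex_of_real (cos (r * k * pi / real (n + 3)))"
  shows "lam n a b c d k = (- 1) ^ (k + 1) * (d + 2 * c * C 1 + 2 * b * C 2 + 2 * a * C 3)"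
proof -
  have cos: "cos (real ((n + r) * k) * pi / real (n + 3)) = (- 1) ^ k * cos (real (3 - r) * k * pi / real (n + 3))"
    if "r \<le> 3" for r
  proof -
    have "real ((n + r) * k) * pi / real (n + 3) = k * pi - real (3 - r) * k * pi / real (n + 3)"
      using that by (simp add: field_simps of_nat_diff)
    then show ?thesis by (simp add: cos_diff)
  qed
  show ?thesis
    using cos[of 0] cos[of 1] cos[of 2]
    by (simp add: lam_def C_def algebra_simps)
qed

text \<open>The row is a seven-term stencil. Since \<open>w\<close> is odd about \<open>0\<close> and about \<open>n + 3\<close>, its zeros at
  \<open>1\<close> and \<open>n + 2\<close> make it vanish wherever the stencil sticks out of the matrix.\<close>
lemma hankel_row_sine:
  assumes p: "p \<in> {1..n}"
    and w: "\<And>j. w j = (\<Sum>k=1..n+2. x k * sine n j k)"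
    and w0: "w 1 = 0" "w (int n + 2) = 0"
  shows "(\<Sum>l=1..n. hankel_entry n a b c d p l * w (int l + 1))
    = (\<Sum>k=1..n+2. lam n a b c d k * x k * sine n (int p + 1) k)"
proof -
  define q where "q = int n + 2 - int p"
  have "w 0 = 0" by (simp add: w sine_def)
  moreover have "w (-1) = 0"
    using w0(1) by (simp add: w sine_minus sum_negf)
  moreover have "w (int n + 3) = 0"
    using sine_reflect[of n 0] by (simp add: w sine_def)
  moreover have "w (int n + 4) = 0"
  proof -
    have "sine n (int n + 4) k = - sine n (int n + 2) k" for k
      using sine_reflect[of n "-1" k] sine_reflect[of n 1 k] by (simp add: sine_minus add.commute)
    then have "w (int n + 4) = - w (int n + 2)"
      unfolding w by (simp only: mult_minus_right sum_negf)
    then show ?thesis using w0 by simp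
  qed
  ultimately have "(\<Sum>l=1..n. hankel_entry n a b c d p l * w (int l + 1))
    = d * w q + c * (w (q + 1) + w (q - 1)) + b * (w (q + 2) + w (q - 2)) + a * (w (q + 3) + w (q - 3))"
    unfolding q_def using w0 by (intro hankel_entry_sum p) auto
  also have "\<dots> = (\<Sum>k=1..n+2. x k * (d * sine n q k + c * (sine n (q + 1) k + sine n (q - 1) k)
      + b * (sine n (q + 2) k + sine n (q - 2) k) + a * (sine n (q + 3) k + sine n (q - 3) k)))"
    unfolding w distrib_left sum.distrib sum_distrib_left by (simp only: mult_ac)
  also have "\<dots> = (\<Sum>k=1..n+2. lam n a b c d k * x k * sine n (int p + 1) k)"
  proof (intro sum.cong refl)
    fix k
    \<comment> \<open>\<open>q\<close> is the mirror image \<open>n + 3 - (p + 1)\<close>, which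
      yields exactly the sign in \<open>lam_alt\<close>.\<close>
    have "sine n q k = (- 1) ^ (k + 1) * sine n (int p + 1) k"
      using sine_reflect[of n "int p + 1" k] by (simp add: q_def algebra_simps)
    then show "x k * (d * sine n q k + c * (sine n (q + 1) k + sine n (q - 1) k)
      + b * (sine n (q + 2) k + sine n (q - 2) k) + a * (sine n (q + 3) k + sine n (q - 3) k))
      = lam n a b c d k * x k * sine n (int p + 1) k"
      unfolding sine_add_diff lam_alt by (simp add: algebra_simps)
  qed
  finally show ?thesis .
qed

lemma hankel_mult_vec:
  assumes v: "v \<in> carrier_vec n" and p: "p \<in> {1..n}"
  shows "(hankel_mat n a b c d *\<^sub>v v) $ (p - 1) = (\<Sum>l=1..n. hankel_entry n a b c d p l * v $ (l - 1))"
proof -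
  have "(hankel_mat n a b c d *\<^sub>v v) $ (p - 1) = (\<Sum>j<n. hankel_entry n a b c d p (j + 1) * v $ j)"
    using v p by (auto simp: hankel_mat_def scalar_prod_def lessThan_atLeast0 intro!: sum.cong)
  also have "\<dots> = (\<Sum>l=1..n. hankel_entry n a b c d p l * v $ (l - 1))"
    by (rule sum.reindex_bij_witness[of _ "\<lambda>l. l - 1" "\<lambda>j. j + 1"]) auto
  finally show ?thesis .
qed

section \<open>The rank-one secular problem\<close>

text \<open>This is the eigenvalue problem of the diagonal matrix of \<open>l\<close> on the
  hyperplane with normal \<open>s\<close> for the bilinear pairing; \<open>\<alpha>\<close> is the
  Lagrange multiplier.\<close>

definition secular_solvable :: "'i set \<Rightarrow> ('i \<Rightarrow> 'a::field) \<Rightarrow> ('i \<Rightarrow> 'a) \<Rightarrow> 'a \<Rightarrow> bool" where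
  "secular_solvable K s l t \<longleftrightarrow>
     (\<exists>x \<alpha>. (\<exists>k\<in>K. x k \<noteq> 0) \<and> (\<forall>k\<in>K. (l k - t) * x k = \<alpha> * s k) \<and> (\<Sum>k\<in>K. x k * s k) = 0)"

text \<open>If \<open>t\<close> is no \<open>l k\<close>, then \<open>x\<close> is forced to be a
  multiple of \<open>s k / (l k - t)\<close>, and the constraint, cleared of denominators, is the
  stated sum. If \<open>t = l k\<close>, only the term of \<open>k\<close> can survive, and both
  sides say that \<open>t\<close> is attained at a second index. The empty sum vanishes without a
  nonzero \<open>x\<close>, hence the condition on \<open>K\<close>.\<close>

lemma secular_solvable_iff:
  assumes fin: "finite K" and s: "\<And>k. k \<in> K \<Longrightarrow> s k \<noteq> 0"
  shows "secular_solvable K s l t \<longleftrightarrow> K \<noteq> {} \<and> (\<Sum>k\<in>K. (s k)\<^sup>2 * (\<Prod>m\<in>K - {k}. (t - l m))) = 0"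
    (is "_ \<longleftrightarrow> _ \<and> ?F = 0")
proof (cases "\<exists>k\<in>K. l k = t")
  case True
  then obtain k where k: "k \<in> K" "l k = t" by blast
  have "(s i)\<^sup>2 * (\<Prod>m\<in>K - {i}. (t - l m)) = 0" if "i \<in> K - {k}" for i
    using that k fin by (auto intro!: prod_zero bexI[of _ k])
  then have F: "?F = (s k)\<^sup>2 * (\<Prod>m\<in>K - {k}. (t - l m))"
    using fin k by (subst sum.remove[of _ k]) (auto intro!: sum.neutral)
  have F0: "?F = 0 \<longleftrightarrow> (\<exists>m\<in>K - {k}. l m = t)"
    unfolding F using fin s k(1) by (auto simp: prod_zero_iff)
  show ?thesis
  proof (cases "\<exists>m\<in>K - {k}. l m = t")
    case True
    then obtain m where m: "m \<in> K" "m \<noteq> k" "l m = t" by blast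
    \<comment> \<open>Supported on two indices with \<open>l = t\<close>, this vector is orthogonal
      to \<open>s\<close> and solves the equations with multiplier 0.\<close>
    define x where "x = (\<lambda>i. if i = k then s m else if i = m then - s k else 0)"
    have "(\<Sum>i\<in>K. x i * s i) = (\<Sum>i\<in>{k, m}. x i * s i)"
      using fin k m by (intro sum.mono_neutral_right) (auto simp: x_def)
    also have "\<dots> = 0" using m(2) by (auto simp: x_def)
    finally have "secular_solvable K s l t"
      unfolding secular_solvable_def using k m s[of m]
      by (intro exI[of _ x] exI[of _ 0]) (auto simp: x_def intro!: bexI[of _ k])
    then show ?thesis using F0 True k by auto
  next
    case False
    have "\<not> secular_solvable K s l t"
    proof
      assume "secular_solvable K s l t"
      then obtain x \<alpha> j where x: "j \<in> K" "x j \<noteq> 0" "\<And>i. i \<in> K \<Longrightarrow> (l i - t) * x i = \<alpha> * s i"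
        "(\<Sum>i\<in>K. x i * s i) = 0"
        unfolding secular_solvable_def by blast
      \<comment> \<open>The equation at \<open>k\<close> reads
        \<open>0 = \<alpha> * s k\<close>.\<close>
      have "\<alpha> = 0" using x(3)[of k] k s by simp
      then have x0: "x i = 0" if "i \<in> K - {k}" for i
        using x(3)[of i] that False by auto
      then have "(\<Sum>i\<in>K. x i * s i) = x k * s k"
        using fin k by (subst sum.remove[of _ k]) auto
      then have "x k = 0" using x(4) s k by simp
      then show False using x0 x(1,2) by (cases "j = k") auto
    qed
    then show ?thesis using F0 False by simp
  qed
next
  case False
  define P where "P = (\<Prod>m\<in>K. t - l m)"
  have P: "P \<noteq> 0" unfolding P_def using fin False by (auto simp: prod_zero_iff)
  have "?F = (\<Sum>k\<in>K. - P * (s k / (l k - t) * s k))"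
  proof (intro sum.cong refl)
    fix k assume k: "k \<in> K"
    then have "P = (t - l k) * (\<Prod>m\<in>K - {k}. (t - l m))"
      unfolding P_def using fin by (rule prod.remove[rotated])
    then have "- P = (l k - t) * (\<Prod>m\<in>K - {k}. (t - l m))"
      by (simp add: algebra_simps)
    moreover have "l k - t \<noteq> 0" using False k by auto
    ultimately show "(s k)\<^sup>2 * (\<Prod>m\<in>K - {k}. (t - l m)) = - P * (s k / (l k - t) * s k)"
      by (simp add: power2_eq_square)
  qed
  then have F: "?F = - P * (\<Sum>k\<in>K. s k / (l k - t) * s k)"
    by (simp only: sum_distrib_left)
  have F0: "?F = 0 \<longleftrightarrow> (\<Sum>k\<in>K. s k / (l k - t) * s k) = 0"
    unfolding F using P by simp
  show ?thesis
  proof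
    assume "secular_solvable K s l t"
    then obtain x \<alpha> j where x: "j \<in> K" "x j \<noteq> 0" "\<And>i. i \<in> K \<Longrightarrow> (l i - t) * x i = \<alpha> * s i"
      "(\<Sum>i\<in>K. x i * s i) = 0"
      unfolding secular_solvable_def by blast
    have xi: "x i = \<alpha> * (s i / (l i - t))" if "i \<in> K" for i
      using x(3)[OF that] that False by (auto simp: field_simps)
    have "\<alpha> \<noteq> 0" using xi[OF x(1)] x(2) by auto
    moreover have "(\<Sum>i\<in>K. x i * s i) = \<alpha> * (\<Sum>k\<in>K. s k / (l k - t) * s k)"
      unfolding sum_distrib_left by (intro sum.cong refl) (simp add: xi)
    ultimately show "K \<noteq> {} \<and> ?F = 0" using F0 x by auto
  next
    assume R: "K \<noteq> {} \<and> ?F = 0"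
    then obtain j where "j \<in> K" by blast
    then show "secular_solvable K s l t"
      unfolding secular_solvable_def using R F0 s False
      by (intro exI[of _ "\<lambda>k. s k / (l k - t)"] exI[of _ 1]) auto
  qed
qed

text \<open>Splitting the distinguished index \<open>p\<close> off the secular sum and dividing by
  the nonzero square of \<open>s p\<close> gives the polynomial.\<close>

lemma poly_secular_form:
  fixes l :: "'i \<Rightarrow> 'a::field"
  assumes fin: "finite A" and inj: "inj_on g A" and p: "p \<notin> g ` A" and s: "s p \<noteq> 0"
  shows "poly ((\<Prod>j\<in>A. [:- l (g j), 1:]) + [:- l p, 1:] *
       (\<Sum>j\<in>A. Polynomial.smult ((s (g j))\<^sup>2 / (s p)\<^sup>2) (\<Prod>m\<in>A - {j}. [:- l (g m), 1:]))) t = 0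
    \<longleftrightarrow> (\<Sum>k\<in>insert p (g ` A). (s k)\<^sup>2 * (\<Prod>m\<in>insert p (g ` A) - {k}. (t - l m))) = 0"
    (is "poly ?p t = 0 \<longleftrightarrow> ?F = 0")
proof -
  have "?F = (s p)\<^sup>2 * (\<Prod>j\<in>A. t - l (g j))
      + (\<Sum>j\<in>A. (s (g j))\<^sup>2 * (\<Prod>m\<in>insert p (g ` A) - {g j}. (t - l m)))"
    using fin p inj
    by (subst sum.insert) (auto simp: sum.reindex prod.reindex)
  also have "(\<Sum>j\<in>A. (s (g j))\<^sup>2 * (\<Prod>m\<in>insert p (g ` A) - {g j}. (t - l m)))
      = (\<Sum>j\<in>A. (s (g j))\<^sup>2 * ((t - l p) * (\<Prod>m\<in>A - {j}. (t - l (g m)))))"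
  proof (intro sum.cong refl)
    fix j assume j: "j \<in> A"
    then have "insert p (g ` A) - {g j} = insert p (g ` (A - {j}))"
      using p inj by (auto simp: inj_on_def)
    moreover have "inj_on g (A - {j})" using inj by (rule inj_on_subset) auto
    ultimately show "(s (g j))\<^sup>2 * (\<Prod>m\<in>insert p (g ` A) - {g j}. (t - l m))
        = (s (g j))\<^sup>2 * ((t - l p) * (\<Prod>m\<in>A - {j}. (t - l (g m))))"
      using fin p by (simp, subst prod.insert) (auto simp: prod.reindex)
  qed
  also have "(s p)\<^sup>2 * (\<Prod>j\<in>A. t - l (g j)) + \<dots> = (s p)\<^sup>2 * poly ?p t"
    using s by (simp add: poly_sum poly_prod sum_distrib_left algebra_simps)
  finally show ?thesis using s by simp
qed

section \<open>Reduction of the eigenvalue problem to the two parity classes\<close>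

lemma eigenvalue_hankel_iff:
  "eigenvalue (hankel_mat n a b c d) t \<longleftrightarrow>
      secular_solvable {k\<in>{1..n+2}. odd k} (sine n 1) (lam n a b c d) t \<or>
      secular_solvable {k\<in>{1..n+2}. even k} (sine n 1) (lam n a b c d) t"
    (is "_ \<longleftrightarrow> secular_solvable ?O ?s ?l t \<or> secular_solvable ?E ?s ?l t")
proof -
  have OE: "{1..n+2} = ?O \<union> ?E" by auto
  have split: "(\<Sum>k=1..n+2. f k) = (\<Sum>k\<in>?O. f k) + (\<Sum>k\<in>?E. f k)" for f :: "nat \<Rightarrow> complex"
    by (subst OE, rule sum.union_disjoint) auto
  have refl_end: "sine n (int n + 2) k = (- 1) ^ (k + 1) * sine n 1 k" for k
    using sine_reflect[of n 1 k] by (simp add: add.commute)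
  have end_sum: "(\<Sum>k=1..n+2. x k * sine n (int n + 2) k)
      = (\<Sum>k\<in>?O. x k * ?s k) - (\<Sum>k\<in>?E. x k * ?s k)" for x :: "nat \<Rightarrow> complex"
    unfolding split by (simp add: refl_end sum_negf)
  show ?thesis
  proof
    assume "eigenvalue (hankel_mat n a b c d) t"
    then obtain v where v: "v \<in> carrier_vec n" "v \<noteq> 0\<^sub>v n" "hankel_mat n a b c d *\<^sub>v v = t \<cdot>\<^sub>v v"
      unfolding eigenvalue_def eigenvector_def by (auto simp: hankel_mat_def)
    \<comment> \<open>\<open>u\<close> pads \<open>v\<close> with zeros at the points 1 and
      \<open>n + 2\<close>, so entry 0 of \<open>v\<close> sits at point 2.\<close>
    define u where "u j = (if j \<in> {2..n+1} then v $ (j - 2) else 0)" for j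
    define x where "x k = 2 / of_nat (n + 3) * (\<Sum>j=1..n+2. u j * sine n (int j) k)" for k
    define w where "w j = (\<Sum>k=1..n+2. x k * sine n j k)" for j
    have w: "w (int i) = u i" if "i \<in> {1..n+2}" for i
      unfolding w_def x_def by (rule sine_inversion[OF that])
    have w1: "w 1 = 0" using w[of 1] by (simp add: u_def)
    have w2: "w (int n + 2) = 0" using w[of "n + 2"] by (simp add: u_def add.commute)
    \<comment> \<open>The values \<open>w 1\<close> and \<open>w (n + 2)\<close> are the sum and the
      difference of the two class sums.\<close>
    have sO: "(\<Sum>k\<in>?O. x k * ?s k) = 0" and sE: "(\<Sum>k\<in>?E. x k * ?s k) = 0"
      using w1 w2 unfolding w_def end_sum split by simp_all
    define y where "y k = (?l k - t) * x k" for k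
    have yz: "(\<Sum>k=1..n+2. y k * sine n (int i) k) = 0" if i: "i \<in> {2..n+1}" for i
    proof -
      define p where "p = i - 1"
      have p: "p \<in> {1..n}" "i = p + 1" using i by (auto simp: p_def)
      have "(\<Sum>k=1..n+2. ?l k * x k * sine n (int p + 1) k)
          = (\<Sum>l=1..n. hankel_entry n a b c d p l * w (int l + 1))"
        by (rule hankel_row_sine[symmetric]) (use p w1 w2 w_def in auto)
      also have "\<dots> = (\<Sum>l=1..n. hankel_entry n a b c d p l * v $ (l - 1))"
      proof (intro sum.cong refl)
        fix l assume "l \<in> {1..n}"
        then show "hankel_entry n a b c d p l * w (int l + 1) = hankel_entry n a b c d p l * v $ (l - 1)"
          using w[of "l + 1"] by (auto simp: u_def add.commute)
      qed
      also have "\<dots> = t * v $ (p - 1)"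
        using hankel_mult_vec[OF v(1) p(1), of a b c d] v p by auto
      also have "v $ (p - 1) = w (int p + 1)"
        using w[of "p + 1"] p by (auto simp: u_def add.commute)
      finally show ?thesis
        unfolding y_def w_def p(2)
        by (simp only: of_nat_add of_nat_1 left_diff_distrib sum_subtractf sum_distrib_left mult.assoc diff_self)
    qed
    \<comment> \<open>The function with coefficients \<open>y\<close> vanishes at all interior
      points. Its two end values, scaled, are \<open>\<alpha>\<close> and \<open>\<beta>\<close>,
      and inversion recovers \<open>y\<close> from them alone.\<close>
    define \<alpha> where "\<alpha> = 2 / of_nat (n + 3) * (\<Sum>k=1..n+2. y k * sine n 1 k)"
    define \<beta> where "\<beta> = 2 / of_nat (n + 3) * (\<Sum>k=1..n+2. y k * sine n (int n + 2) k)"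
    have y: "y k = (\<alpha> + (- 1) ^ (k + 1) * \<beta>) * ?s k" if k: "k \<in> {1..n+2}" for k
    proof -
      have "(\<Sum>i=1..n+2. (\<Sum>m=1..n+2. y m * sine n (int i) m) * sine n (int i) k)
        = (\<Sum>i\<in>{1,n+2}. (\<Sum>m=1..n+2. y m * sine n (int i) m) * sine n (int i) k)"
      proof (rule sum.mono_neutral_right)
        show "\<forall>i\<in>{1..n + 2} - {1, n + 2}. (\<Sum>m=1..n+2. y m * sine n (int i) m) * sine n (int i) k = 0"
        proof
          fix i assume "i \<in> {1..n + 2} - {1, n + 2}"
          then have "i \<in> {2..n+1}" by auto
          then show "(\<Sum>m=1..n+2. y m * sine n (int i) m) * sine n (int i) k = 0"
            using yz by simp
        qed
      qed auto
      also have "\<dots> = (\<Sum>m=1..n+2. y m * sine n 1 m) * ?s k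
          + (\<Sum>m=1..n+2. y m * sine n (int n + 2) m) * sine n (int n + 2) k"
        by (simp add: add.commute)
      finally have "y k = 2 / of_nat (n + 3) * ((\<Sum>m=1..n+2. y m * sine n 1 m) * ?s k
          + (\<Sum>m=1..n+2. y m * sine n (int n + 2) m) * sine n (int n + 2) k)"
        using sine_coefficients[OF k, of y] by (simp only:)
      then show ?thesis
        unfolding \<alpha>_def \<beta>_def refl_end[of k] by (simp only: distrib_left distrib_right mult_ac)
    qed
    have "\<exists>k\<in>{1..n+2}. x k \<noteq> 0"
    proof (rule ccontr)
      assume "\<not> ?thesis"
      then have w0: "w j = 0" for j by (simp add: w_def)
      have "v = 0\<^sub>v n"
      proof (rule eq_vecI)
        fix i assume "i < dim_vec (0\<^sub>v n)"
        then show "v $ i = 0\<^sub>v n $ i"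
          using w[of "i + 2"] w0 by (simp add: u_def)
      qed (use v in auto)
      then show False using v by simp
    qed
    \<comment> \<open>On odd \<open>k\<close> the sign is 1 and the multiplier is
      \<open>\<alpha> + \<beta>\<close>; on even \<open>k\<close> it is
      \<open>\<alpha> - \<beta>\<close>.\<close>
    then consider "\<exists>k\<in>?O. x k \<noteq> 0" | "\<exists>k\<in>?E. x k \<noteq> 0" by blast
    then show "secular_solvable ?O ?s ?l t \<or> secular_solvable ?E ?s ?l t"
    proof cases
      case 1
      then have "secular_solvable ?O ?s ?l t"
        unfolding secular_solvable_def
        by (intro exI[of _ x] exI[of _ "\<alpha> + \<beta>"]) (use y sO in \<open>auto simp: y_def\<close>)
      then show ?thesis ..
    next
      case 2
      then have "secular_solvable ?E ?s ?l t"
        unfolding secular_solvable_def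
        by (intro exI[of _ x] exI[of _ "\<alpha> - \<beta>"]) (use y sE in \<open>auto simp: y_def\<close>)
      then show ?thesis ..
    qed
  next
    assume "secular_solvable ?O ?s ?l t \<or> secular_solvable ?E ?s ?l t"
    then obtain K and \<epsilon> :: complex where K: "secular_solvable K ?s ?l t" "K = ?O \<and> \<epsilon> = 1 \<or> K = ?E \<and> \<epsilon> = - 1"
      by blast
    have K_sub: "K \<subseteq> {1..n+2}" using K(2) by auto
    have \<epsilon>: "\<epsilon> * (- 1) ^ (k + 1) = (if k \<in> K then 1 else - 1)" if "k \<in> {1..n+2}" for k
      using K(2) that by (cases "even k") auto
    obtain x' \<alpha> where x': "\<exists>k\<in>K. x' k \<noteq> 0" "\<forall>k\<in>K. (?l k - t) * x' k = \<alpha> * ?s k" "(\<Sum>k\<in>K. x' k * ?s k) = 0"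
      using K(1) unfolding secular_solvable_def by blast
    define x where "x k = (if k \<in> K then x' k else 0)" for k
    define w where "w j = (\<Sum>k=1..n+2. x k * sine n j k)" for j
    \<comment> \<open>The combination of the two end points doubles on \<open>K\<close> and cancels
      on the other class, whence the factor \<open>\<alpha> / 2\<close>.\<close>
    have y: "(?l k - t) * x k = \<alpha> / 2 * (?s k + \<epsilon> * sine n (int n + 2) k)" if k: "k \<in> {1..n+2}" for k
    proof -
      have "?s k + \<epsilon> * sine n (int n + 2) k = ?s k + \<epsilon> * (- 1) ^ (k + 1) * ?s k"
        unfolding refl_end by (simp only: mult.assoc)
      also have "\<dots> = (if k \<in> K then 2 * ?s k else 0)"
        unfolding \<epsilon>[OF k] by simp
      finally show ?thesis using x'(2) by (simp add: x_def)
    qed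
    have w1: "w 1 = 0"
    proof -
      have "w 1 = (\<Sum>k\<in>K. x' k * ?s k)"
        unfolding w_def using K_sub by (intro sum.mono_neutral_cong_right) (auto simp: x_def)
      then show ?thesis using x'(3) by simp
    qed
    have w2: "w (int n + 2) = 0"
    proof -
      have \<epsilon>2: "\<epsilon> * \<epsilon> = 1" using K(2) by auto
      have "\<epsilon> * w (int n + 2) = (\<Sum>k=1..n+2. x k * (\<epsilon> * (- 1) ^ (k + 1) * ?s k))"
        unfolding w_def refl_end sum_distrib_left by (simp only: mult_ac)
      also have "\<dots> = w 1"
        unfolding w_def by (intro sum.cong refl) (simp only: \<epsilon>, simp add: x_def)
      finally have "\<epsilon> * w (int n + 2) = 0" using w1 by simp
      then show ?thesis using \<epsilon>2 by auto
    qed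
    \<comment> \<open>By \<open>y\<close>, the coefficients are those of a function supported at the
      end points, so orthogonality gives 0 at the interior point \<open>p + 1\<close>.\<close>
    have yz: "(\<Sum>k=1..n+2. (?l k - t) * x k * sine n (int p + 1) k) = 0" if p: "p \<in> {1..n}" for p
    proof -
      have "(\<Sum>k=1..n+2. (?l k - t) * x k * sine n (int p + 1) k)
          = (\<Sum>k=1..n+2. \<alpha> / 2 * (sine n (int 1) k * sine n (int (p + 1)) k)
              + \<alpha> / 2 * \<epsilon> * (sine n (int (n + 2)) k * sine n (int (p + 1)) k))"
        by (intro sum.cong refl) (simp only: y, simp add: algebra_simps)
      also have "\<dots> = \<alpha> / 2 * (\<Sum>k=1..n+2. sine n (int 1) k * sine n (int (p + 1)) k)
          + \<alpha> / 2 * \<epsilon> * (\<Sum>k=1..n+2. sine n (int (n + 2)) k * sine n (int (p + 1)) k)"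
        by (simp only: sum.distrib sum_distrib_left)
      also have "\<dots> = 0"
        using p by (subst (1 2) sine_orthogonal) auto
      finally show ?thesis .
    qed
    define v where "v = vec n (\<lambda>i. w (int i + 2))"
    have v: "v \<in> carrier_vec n" by (simp add: v_def)
    have v_index: "v $ (l - 1) = w (int l + 1)" if "l \<in> {1..n}" for l
      using that by (auto simp: v_def of_nat_diff add.commute)
    have "v \<noteq> 0\<^sub>v n"
    proof
      assume v0: "v = 0\<^sub>v n"
      \<comment> \<open>If \<open>v\<close> vanished, so would \<open>w\<close> at all
        \<open>n + 2\<close> points, and inversion would annihilate every coefficient
        \<open>x k\<close>.\<close>
      have w0: "w (int i) = 0" if "i \<in> {1..n+2}" for i
      proof -
        consider "i = 1" | "i = n + 2" | "i - 1 \<in> {1..n}" using \<open>i \<in> {1..n+2}\<close> by fastforce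
        then show ?thesis
        proof cases
          case 3
          then show ?thesis using v_index[OF 3] v0 by (auto simp: of_nat_diff)
        qed (use w1 w2 in \<open>simp_all add: add.commute\<close>)
      qed
      have "x k = 0" if "k \<in> {1..n+2}" for k
      proof -
        have "x k = 2 / of_nat (n + 3) * (\<Sum>i=1..n+2. w (int i) * sine n (int i) k)"
          unfolding w_def by (rule sine_coefficients[OF that])
        then show ?thesis using w0 by simp
      qed
      then show False using x'(1) K_sub unfolding x_def by (metis subsetD)
    qed
    moreover have "hankel_mat n a b c d *\<^sub>v v = t \<cdot>\<^sub>v v"
    proof (rule eq_vecI)
      fix i assume "i < dim_vec (t \<cdot>\<^sub>v v)"
      then have i: "i + 1 \<in> {1..n}" using v by simp
      have "(hankel_mat n a b c d *\<^sub>v v) $ i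
          = (\<Sum>l=1..n. hankel_entry n a b c d (i + 1) l * v $ (l - 1))"
        using hankel_mult_vec[OF v i] by simp
      also have "\<dots> = (\<Sum>l=1..n. hankel_entry n a b c d (i + 1) l * w (int l + 1))"
        by (intro sum.cong refl) (simp only: v_index)
      also have "\<dots> = (\<Sum>k=1..n+2. ?l k * x k * sine n (int (i + 1) + 1) k)"
        by (rule hankel_row_sine[OF i w_def w1 w2])
      also have "\<dots> = t * w (int (i + 1) + 1)"
        using yz[OF i] unfolding w_def
        by (simp only: left_diff_distrib sum_subtractf sum_distrib_left mult.assoc right_minus_eq)
      also have "\<dots> = (t \<cdot>\<^sub>v v) $ i"
        using v_index[OF i] i v by simp
      finally show "(hankel_mat n a b c d *\<^sub>v v) $ i = (t \<cdot>\<^sub>v v) $ i" .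
    qed (simp add: hankel_mat_def v_def)
    ultimately show "eigenvalue (hankel_mat n a b c d) t"
      unfolding eigenvalue_def eigenvector_def using v by (auto simp: hankel_mat_def)
  qed
qed

section \<open>Identification with the polynomials of the theorem\<close>

text \<open>The separate index \<open>q\<close> allows the ratios to be normalised at an index other
  than \<open>p\<close> with the same squared sine.\<close>

lemma secular_solvable_sine_iff:
  fixes l :: "nat \<Rightarrow> complex"
  assumes "finite A" "inj_on g A" "p \<notin> g ` A" "insert p (g ` A) \<subseteq> {1..n+2}"
    and q: "(sin (real q * pi / real (n + 3)))\<^sup>2 = (sin (real p * pi / real (n + 3)))\<^sup>2"
  shows "secular_solvable (insert p (g ` A)) (sine n 1) l t \<longleftrightarrow>
    poly ((\<Prod>j\<in>A. lin (l (g j))) + lin (l p) *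
       (\<Sum>j\<in>A. Polynomial.smult (sin_ratio n (g j) q) (\<Prod>m\<in>A - {j}. lin (l (g m))))) t = 0"
proof -
  have ratio: "sin_ratio n k q = (sine n 1 k)\<^sup>2 / (sine n 1 p)\<^sup>2" for k
    unfolding sin_ratio_def q by (simp add: sine_def)
  have fin: "finite (insert p (g ` A))" using assms(1) by simp
  have nz: "sine n 1 k \<noteq> 0" if "k \<in> insert p (g ` A)" for k
    using that assms(4) by (intro sine_one_nonzero) blast
  show ?thesis
    unfolding ratio
    using secular_solvable_iff[where s = "sine n 1" and l = l and t = t, OF fin nz]
      poly_secular_form[where s = "sine n 1" and l = l and t = t, OF assms(1-3) nz[OF insertI1]]
    by simp
qed

theorem theorem1:
  fixes n :: nat and a b c d :: complex
  assumes "n \<ge> 1"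
  shows "(even n \<longrightarrow>
            (\<forall>t. eigenvalue (hankel_mat n a b c d) t \<longleftrightarrow>
                 poly (f_even n a b c d) t = 0 \<or> poly (g_even n a b c d) t = 0)) \<and>
         (odd n \<longrightarrow>
            (\<forall>t. eigenvalue (hankel_mat n a b c d) t \<longleftrightarrow>
                 poly (f_odd n a b c d) t = 0 \<or> poly (g_odd n a b c d) t = 0))"
proof (intro conjI impI allI)
  fix t
  assume "even n"
  then obtain h where h: "n = 2 * h" by blast
  have O: "{k\<in>{1..n+2}. odd k} = insert 1 ((\<lambda>j. 2 * j + 1) ` {1..n div 2})"
    unfolding h by (auto simp: image_iff Ball_def Bex_def; presburger)
  have E: "{k\<in>{1..n+2}. even k} = insert (n + 2) ((\<lambda>j. 2 * j) ` {1..n div 2})"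
    unfolding h by (auto simp: image_iff Ball_def Bex_def; presburger)
  \<comment> \<open>Here \<open>g_even\<close> singles out the index \<open>n + 2\<close> but
    divides by the squared sine at index 1; the two angles are supplementary.\<close>
  have q: "(sin (real 1 * pi / real (n + 3)))\<^sup>2 = (sin (real (n + 2) * pi / real (n + 3)))\<^sup>2"
  proof -
    have "real (n + 2) * pi / real (n + 3) = pi - pi / real (n + 3)" by (simp add: field_simps)
    then show ?thesis by simp
  qed
  have "secular_solvable (insert 1 ((\<lambda>j. 2 * j + 1) ` {1..n div 2})) (sine n 1) (lam n a b c d) t
      \<longleftrightarrow> poly (f_even n a b c d) t = 0"
    unfolding f_even_def by (rule secular_solvable_sine_iff) (auto simp: inj_on_def h)
  moreover have "secular_solvable (insert (n + 2) ((\<lambda>j. 2 * j) ` {1..n div 2})) (sine n 1) (lam n a b c d) t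
      \<longleftrightarrow> poly (g_even n a b c d) t = 0"
    unfolding g_even_def by (rule secular_solvable_sine_iff) (use q in \<open>auto simp: inj_on_def h\<close>)
  ultimately show "eigenvalue (hankel_mat n a b c d) t \<longleftrightarrow>
      poly (f_even n a b c d) t = 0 \<or> poly (g_even n a b c d) t = 0"
    unfolding eigenvalue_hankel_iff O E by (simp only:)
next
  fix t
  assume "odd n"
  then obtain h where h: "n = 2 * h + 1" by (elim oddE)
  have O: "{k\<in>{1..n+2}. odd k} = insert 1 ((\<lambda>j. 2 * j + 1) ` {1..(n + 1) div 2})"
    unfolding h by (auto simp: image_iff Ball_def Bex_def; presburger)
  \<comment> \<open>The largest even index is now \<open>n + 1\<close>. For \<open>n = 1\<close> it
    is the only one, and the image is empty.\<close>
  have E: "{k\<in>{1..n+2}. even k} = insert (n + 1) ((\<lambda>j. 2 * j) ` {1..(n - 1) div 2})"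
    unfolding h by (auto simp: image_iff Ball_def Bex_def; presburger)
  have "secular_solvable (insert 1 ((\<lambda>j. 2 * j + 1) ` {1..(n + 1) div 2})) (sine n 1) (lam n a b c d) t
      \<longleftrightarrow> poly (f_odd n a b c d) t = 0"
    unfolding f_odd_def by (rule secular_solvable_sine_iff) (auto simp: inj_on_def h)
  moreover have "secular_solvable (insert (n + 1) ((\<lambda>j. 2 * j) ` {1..(n - 1) div 2})) (sine n 1) (lam n a b c d) t
      \<longleftrightarrow> poly (g_odd n a b c d) t = 0"
    unfolding g_odd_def by (rule secular_solvable_sine_iff) (use h in \<open>auto simp: inj_on_def h\<close>)
  ultimately show "eigenvalue (hankel_mat n a b c d) t \<longleftrightarrow>
      poly (f_odd n a b c d) t = 0 \<or> poly (g_odd n a b c d) t = 0"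
    unfolding eigenvalue_hankel_iff O E by (simp only:)
qed

end
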